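(* Let $\underline{x}$ and $\bar{x}$ be the equilibrium disclosure thresholds defined in the context. 1. The likelihood of misleading disclosure decreases with the investor's competence $\beta$ and the firm's information environment $q$. 2. Holding constant the initial evidence $r$, the stock price reaction to a simple report (or equivalently, price volatility following a simple report) decreases with the investor's competence and increases with the firm's information environment. 3. The extremity of elaborate reports decreases with the investor's competence. 4. When $r<r_0$, the extremity of negative (positive) reports increases (decreases) with the firm's information environment. When $r>r_0$, the extremity of positive (negative) reports increases (decreases) with the firm's information environment.
   Context: A firm has value $\theta=rx$, where $r$ is a continuous variable on $\mathbb{R}^+$ with mean $r_0$, and $x$ is a continuous variable on $\mathbb{R}$ with density $g$, cdf $G$ and mean $\mu_0>0$, independent of $r$. An investor who knows $r$ always discloses it, and also knows $x$ (is *informed* ) with probability $\beta$, the investor's "competence". The investor takes a position in the stock at price $r_0\mu_0$ before disclosure and closes it afterwards. After the investor's disclosure, $\theta$ is revealed by other sources with probability $q$, the firm's "information environment". In the unique equilibrium, for each realization $r$, the informed investor withholds $x$, i.e. issues a *simple* report disclosing only $r$, exactly when $x\in[\underline{x},\bar{x}]$, and otherwise issues an *elaborate* report disclosing both $r$ and $x$. The thresholds are uniquely determined as follows. When $r<r_0$: $$\beta\int_{\underline{x}}^{\bar{x}}\bigl(G(x)-G(\bar{x})\bigr)dx-(1-\beta)(\mu_0-\underline{x})=0,\qquad (1+q)\bar{x}+(1-q)\underline{x}=\frac{2r_0\mu_0}{r}.$$ When $r>r_0$: $$\beta\int_{\underline{x}}^{\bar{x}}\bigl(G(x)-G(\underline{x})\bigr)dx-(1-\beta)(\mu_0-\bar{x})=0,\qquad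 (1-q)\bar{x}+(1+q)\underline{x}=\frac{2r_0\mu_0}{r}.$$ *Misleading disclosure:* the informed investor's simple report is misleading if it decreases (increases) the price when $rx>r_0\mu_0$ ($rx<r_0\mu_0$). It is captured by the region $x\in[\frac{r_0\mu_0}{r},\bar{x}]$ when $r<r_0$ and by the region $x\in[\underline{x},\frac{r_0\mu_0}{r}]$ when $r>r_0$; statements about its likelihood refer to these regions. *Price reaction to a simple report* (when $\theta$ is not revealed by other sources): $|r_0\mu_0-r\mu_{ND}|$, where $\mu_{ND}$ is the market's posterior expectation of $x$ after a simple report; in equilibrium it equals $r_0\mu_0-r\underline{x}$ when $r<r_0$ and $r\bar{x}-r_0\mu_0$ when $r>r_0$. *Extremity of negative (positive) elaborate reports:* $\Pr(x\in[\underline{x},\frac{r_0\mu_0}{r}])$ ($\Pr(x\in[\frac{r_0\mu_0}{r},\bar{x}])$). *Overall extremity of elaborate reports:* $\Pr(x\in[\underline{x},\bar{x}])$. *)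

theory Defs
  imports "HOL-Probability.Probability"
begin

definition mean :: "real measure \<Rightarrow> real"
  where "mean M = (\<integral>x. x \<partial>M)"

text \<open>
  Throughout, \<open>X\<close> is the law of \<open>x\<close>, \<open>R\<close> the law of \<open>r\<close>, \<open>r0\<close> the mean of \<open>r\<close>,
  \<open>\<beta>\<close> the investor's competence and \<open>q\<close> the firm's information environment.
  The case \<open>r = r0\<close>, an event of probability zero, is left unconstrained.
\<close>

definition is_thresholds ::
    "real measure \<Rightarrow> real \<Rightarrow> real \<Rightarrow> real \<Rightarrow> real \<Rightarrow> real \<times> real \<Rightarrow> bool"
  where "is_thresholds X r0 \<beta> q r = (\<lambda>(xl, xu). xl \<le> xu \<and>
    (r < r0 \<longrightarrow>
       \<beta> * integral {xl..xu} (\<lambda>x. cdf X x - cdf X xu) - (1 - \<beta>) * (mean X - xl) = 0 \<and>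
       (1 + q) * xu + (1 - q) * xl = 2 * r0 * mean X / r) \<and>
    (r > r0 \<longrightarrow>
       \<beta> * integral {xl..xu} (\<lambda>x. cdf X x - cdf X xl) - (1 - \<beta>) * (mean X - xu) = 0 \<and>
       (1 - q) * xu + (1 + q) * xl = 2 * r0 * mean X / r))"

definition x_low :: "real measure \<Rightarrow> real \<Rightarrow> real \<Rightarrow> real \<Rightarrow> real \<Rightarrow> real"
  where "x_low X r0 \<beta> q r = fst (THE p. is_thresholds X r0 \<beta> q r p)"

definition x_high :: "real measure \<Rightarrow> real \<Rightarrow> real \<Rightarrow> real \<Rightarrow> real \<Rightarrow> real"
  where "x_high X r0 \<beta> q r = snd (THE p. is_thresholds X r0 \<beta> q r p)"

definition misleading_region ::
    "real measure \<Rightarrow> real \<Rightarrow> real \<Rightarrow> real \<Rightarrow> real \<Rightarrow> real set"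
  where "misleading_region X r0 \<beta> q r =
    (if r < r0 then {r0 * mean X / r .. x_high X r0 \<beta> q r}
     else if r0 < r then {x_low X r0 \<beta> q r .. r0 * mean X / r}
     else {})"

definition negative_region ::
    "real measure \<Rightarrow> real \<Rightarrow> real \<Rightarrow> real \<Rightarrow> real \<Rightarrow> real set"
  where "negative_region X r0 \<beta> q r = {x_low X r0 \<beta> q r .. r0 * mean X / r}"

definition positive_region ::
    "real measure \<Rightarrow> real \<Rightarrow> real \<Rightarrow> real \<Rightarrow> real \<Rightarrow> real set"
  where "positive_region X r0 \<beta> q r = {r0 * mean X / r .. x_high X r0 \<beta> q r}"

definition overall_region ::
    "real measure \<Rightarrow> real \<Rightarrow> real \<Rightarrow> real \<Rightarrow> real \<Rightarrow> real set"
  where "overall_region X r0 \<beta> q r = {x_low X r0 \<beta> q r .. x_high X r0 \<beta> q r}"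

text \<open>
  Probability that \<open>x\<close> falls in the region \<open>A r\<close> attached to the realized \<open>r\<close>, before \<open>r\<close> is
  known. The product measure encodes the independence of \<open>r\<close> and \<open>x\<close>; the guard \<open>0 < r\<close> discards
  an \<open>R\<close>-null set on which the regions carry no meaning.
\<close>

definition ex_ante_prob :: "real measure \<Rightarrow> real measure \<Rightarrow> (real \<Rightarrow> real set) \<Rightarrow> real"
  where "ex_ante_prob R X A = measure (R \<Otimes>\<^sub>M X) {(r, x). 0 < r \<and> x \<in> A r}"

text \<open>
  Market's posterior expectation of \<open>x\<close> after a simple report. The Boolean component says whether
  the investor is informed, independently of \<open>x\<close>; a simple report is issued by an uninformed
  investor, or by an informed one who observes \<open>x\<close> between the thresholds. As \<open>r\<close> is independent
  of both components, it enters only through the thresholds.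
\<close>

definition simple_report :: "real \<Rightarrow> real \<Rightarrow> (bool \<times> real) set"
  where "simple_report xl xu = {(informed, x). informed \<longrightarrow> x \<in> {xl..xu}}"

definition mu_ND :: "real measure \<Rightarrow> real \<Rightarrow> real \<Rightarrow> real \<Rightarrow> real \<Rightarrow> real"
  where "mu_ND X r0 \<beta> q r =
    (\<integral>\<omega>. snd \<omega> \<partial>uniform_measure (measure_pmf (bernoulli_pmf \<beta>) \<Otimes>\<^sub>M X)
                  (simple_report (x_low X r0 \<beta> q r) (x_high X r0 \<beta> q r)))"

definition price_reaction :: "real measure \<Rightarrow> real \<Rightarrow> real \<Rightarrow> real \<Rightarrow> real \<Rightarrow> real"
  where "price_reaction X r0 \<beta> q r = \<bar>r0 * mean X - r * mu_ND X r0 \<beta> q r\<bar>"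

text \<open>
  Monotonicity is strict when \<open>x\<close> has full support, i.e. its cdf is strictly increasing; gaps in
  the support can make the quantities below locally constant in the parameters.
\<close>

definition decreases_on :: "real measure \<Rightarrow> real set \<Rightarrow> (real \<Rightarrow> real) \<Rightarrow> bool"
  where "decreases_on X S h \<longleftrightarrow>
    antimono_on S h \<and> (strict_mono (cdf X) \<longrightarrow> strict_antimono_on S h)"

definition increases_on :: "real measure \<Rightarrow> real set \<Rightarrow> (real \<Rightarrow> real) \<Rightarrow> bool"
  where "increases_on X S h \<longleftrightarrow>
    mono_on S h \<and> (strict_mono (cdf X) \<longrightarrow> strict_mono_on S h)"

end

theory Submission
  imports Defs
begin

text \<open>
  For \<open>r < r0\<close> put \<open>c = r0 m / r\<close>, with \<open>m\<close> the mean of \<open>x\<close>, and let \<open>D(l, u)\<close> be the integral of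
  \<open>G(u) - G(x)\<close> over \<open>[l, u]\<close>. The thresholds solve \<open>(1 - \<beta>) (l - m) = \<beta> D(l, u)\<close> on the line
  \<open>(1 + q) u + (1 - q) l = 2 c\<close>. Along that line \<open>D\<close> decreases in \<open>l\<close> and vanishes at \<open>l = c\<close>, so
  there is exactly one solution, and it satisfies \<open>m \<le> l < c < u\<close>. Raising \<open>\<beta>\<close> forces \<open>l\<close> up and
  hence \<open>u\<close> down. Raising \<open>q\<close> tilts the line towards smaller \<open>u\<close>, which forces \<open>l\<close> and \<open>u\<close> down.
  Since \<open>D(l, u)\<close> is also the expectation of \<open>x - l\<close> restricted to \<open>[l, u]\<close>, the first equation
  says that the posterior mean after a simple report is \<open>l\<close>. The case \<open>r > r0\<close> follows by
  reflecting \<open>x\<close>, and the ex ante claims by integrating over \<open>r\<close>; the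
  thresholds are measurable in \<open>r\<close> because they are monotone on either side of \<open>r0\<close>.
\<close>

subsection \<open>The threshold equations of a monotone function\<close>

text \<open>\<open>P\<close> is convex with continuous derivative \<open>F\<close>. No limits are
  imposed on \<open>F\<close>, so that the reflection of a cdf, which takes values in [-1, 0], is an
  instance too and one argument serves both signs of \<open>r - r0\<close>.\<close>

locale smooth_convex =
  fixes F P :: "real \<Rightarrow> real"
  assumes mono_F: "mono F"
    and continuous_F: "continuous_on UNIV F"
    and primitive: "(P has_real_derivative F x) (at x)"
begin

text \<open>\<open>gap l u\<close> is the integral of \<open>F u - F x\<close> over \<open>[l, u]\<close>.\<close>

definition gap :: "real \<Rightarrow> real \<Rightarrow> real"
  where "gap l u = (u - l) * F u - (P u - P l)"

lemma gap_same [simp]: "gap x x = 0"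
  by (simp add: gap_def)

section \<open>Monotonicity of the gap in its endpoints\<close>

lemma increment_bounds:
  assumes "x \<le> y"
  shows "(y - x) * F x \<le> P y - P x" "P y - P x \<le> (y - x) * F y"
proof -
  consider "x = y" | "x < y" using assms by linarith
  then have "(y - x) * F x \<le> P y - P x \<and> P y - P x \<le> (y - x) * F y"
  proof cases
    case 2
    then obtain z where z: "x < z" "z < y" "P y - P x = (y - x) * F z"
      using MVT2[of x y P F] primitive by blast
    have "F x \<le> F z" "F z \<le> F y" using z mono_F by (auto simp: mono_def)
    then show ?thesis using 2 z by (simp add: mult_left_mono)
  qed auto
  then show "(y - x) * F x \<le> P y - P x" "P y - P x \<le> (y - x) * F y" by auto
qed

lemma increment_strict:
  assumes "strict_mono F" "x < y"
  shows "P y - P x < (y - x) * F y"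
proof -
  obtain z where z: "x < z" "z < y" "P y - P x = (y - x) * F z"
    using MVT2[of x y P F] primitive assms(2) by blast
  then show ?thesis using assms by (simp add: strict_mono_def)
qed

text \<open>The gap is the area between the graph of \<open>F\<close> and the horizontal line at
  height \<open>F u\<close>. Widening the interval lengthens this area, and moving the upper end up
  also raises the line.\<close>

lemma gap_mono:
  assumes "l \<le> l'" "l' \<le> u" "u \<le> u'"
  shows "gap l' u \<le> gap l u'"
proof -
  have F: "F l' \<le> F u" "F u \<le> F u'" using assms mono_F by (auto simp: mono_def)
  have "(l' - l) * F l' \<le> (l' - l) * F u" "(u - l) * F u \<le> (u - l) * F u'"
    using F assms by (auto intro: mult_left_mono)
  then show ?thesis
    using increment_bounds[OF assms(1)] increment_bounds[OF assms(3)]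
    unfolding gap_def by (simp add: algebra_simps)
qed

text \<open>The gain is \<open>(u - l) * (F u' - F u)\<close>, which is nonnegative, plus the gap
  over \<open>[u, u']\<close>, which is positive. The case \<open>l = u\<close> gives positivity of
  the gap.\<close>

lemma gap_strict:
  assumes "strict_mono F" "l \<le> u" "u < u'"
  shows "gap l u < gap l u'"
proof -
  have F: "F u \<le> F u'" using assms mono_F by (auto simp: mono_def)
  have "(u - l) * F u \<le> (u - l) * F u'"
    using F assms by (auto intro: mult_left_mono)
  then show ?thesis
    using increment_strict[OF assms(1,3)] unfolding gap_def by (simp add: algebra_simps)
qed

lemma gap_nonneg: "l \<le> u \<Longrightarrow> 0 \<le> gap l u"
  using gap_mono[of l u u u] by simp

text \<open>
  With \<open>F\<close> the cdf of \<open>x\<close>, these are the threshold equations for \<open>r < r0\<close>, with \<open>m\<close> the mean and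
  \<open>c = r0 m / r > m\<close> the break-even value. The equations for \<open>r > r0\<close> are those of the reflected
  function \<open>\<lambda>x. - F (- x)\<close>, with \<open>(l, u, m, c)\<close> replaced by \<open>(- u, - l, - m, - c)\<close>.
\<close>

definition equilibrium :: "real \<Rightarrow> real \<Rightarrow> real \<Rightarrow> real \<Rightarrow> real \<Rightarrow> real \<Rightarrow> bool"
  where "equilibrium \<beta> q m c l u \<longleftrightarrow> l \<le> u \<and> (1 - \<beta>) * (l - m) = \<beta> * gap l u \<and>
    (1 + q) * u + (1 - q) * l = 2 * c"

section \<open>Location, comparative statics, existence and uniqueness of equilibria\<close>

lemma equilibriumD:
  assumes "equilibrium \<beta> q m c l u"
  shows "l \<le> u" "(1 - \<beta>) * (l - m) = \<beta> * gap l u" "(1 + q) * (u - c) = (1 - q) * (c - l)"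
  using assms unfolding equilibrium_def by (auto simp: field_simps)

lemma equilibrium_bounds:
  assumes e: "equilibrium \<beta> q m c l u" and b: "0 < \<beta>" "\<beta> < 1" "0 \<le> q" "q < 1" "m < c"
  shows "m \<le> l" "l < c" "c < u"
proof -
  note E = equilibriumD[OF e]
  have "0 \<le> (1 - \<beta>) * (l - m)" using E(2) gap_nonneg[OF E(1)] b by simp
  then show ml: "m \<le> l" using b by (simp add: zero_le_mult_iff)
  show lc: "l < c"
  proof (rule ccontr)
    \<comment> \<open>The line puts \<open>l\<close> and \<open>u\<close> on opposite sides of
      \<open>c\<close>, so the interval would collapse to a point. Then the gap vanishes and
      \<open>l = m < c\<close>.\<close>
    assume n: "\<not> l < c"
    then have "(1 + q) * (u - c) \<le> 0" using E(3) b by (simp add: mult_nonneg_nonpos)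
    then have "u \<le> c" using b by (simp add: mult_le_0_iff)
    then have "u = l" using n E(1) by simp
    then have "(1 - \<beta>) * (l - m) = 0" using E(2) by simp
    then show False using n b by simp
  qed
  have "(1 + q) * (u - c) > 0" using E(3) lc b by simp
  then show "c < u" using b by (simp add: zero_less_mult_iff)
qed

text \<open>If \<open>l\<close> fell, \<open>u\<close> would rise along the line, so
  \<open>\<beta> * gap l u\<close> would not shrink. But \<open>(1 - \<beta>) * (l - m)\<close>
  would shrink strictly, as its first factor falls too and \<open>m \<le> l\<close>.\<close>

lemma equilibrium_competence:
  assumes e: "equilibrium \<beta> q m c l u" and e': "equilibrium \<beta>' q m c l' u'"
    and b: "0 < \<beta>" "\<beta> < \<beta>'" "\<beta>' < 1" "0 \<le> q" "q < 1" "m < c"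
  shows "l \<le> l'" "u' \<le> u" "strict_mono F \<Longrightarrow> l < l'" "strict_mono F \<Longrightarrow> u' < u"
proof -
  note E = equilibriumD[OF e] and E' = equilibriumD[OF e']
  note B = equilibrium_bounds[OF e] and B' = equilibrium_bounds[OF e']
  have line: "(1 + q) * (u - u') = (1 - q) * (l' - l)"
    using E(3) E'(3) by (simp add: algebra_simps)
  have ml: "m \<le> l" using B b by simp
  show ll: "l \<le> l'"
  proof (rule ccontr)
    assume n: "\<not> l \<le> l'"
    then have "(1 + q) * (u - u') < 0" using line b by (simp add: mult_pos_neg)
    then have "u < u'" using b by (simp add: mult_less_0_iff)
    then have "gap l u \<le> gap l' u'" using n E(1) by (intro gap_mono) auto
    then have "\<beta> * gap l u \<le> \<beta>' * gap l' u'" using b gap_nonneg[OF E(1)] by (intro mult_mono) auto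
    then have "(1 - \<beta>) * (l - m) \<le> (1 - \<beta>') * (l' - m)" using E E' by simp
    also have "\<dots> < (1 - \<beta>') * (l - m)" using n b by simp
    also have "\<dots> \<le> (1 - \<beta>) * (l - m)" using b ml by (intro mult_right_mono) auto
    finally show False by simp
  qed
  have "0 \<le> (1 + q) * (u - u')" using line ll b by simp
  then show "u' \<le> u" using b by (simp add: zero_le_mult_iff)
  show s: "l < l'" if F: "strict_mono F"
  proof (rule ccontr)
    assume "\<not> l < l'"
    \<comment> \<open>Equal lower ends give equal upper ends, so one positive gap would carry the
      larger weight \<open>\<beta>'\<close> against the smaller weight
      \<open>1 - \<beta>'\<close>.\<close>
    then have l: "l' = l" using ll by simp
    then have u: "u' = u" using line b by simp
    have "l < u" using B b by simp
    then have "0 < gap l u" using gap_strict[OF F, of l l u] by simp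
    then have "\<beta> * gap l u < \<beta>' * gap l u" using b by simp
    then have "(1 - \<beta>) * (l - m) < (1 - \<beta>') * (l - m)" using E E' l u by simp
    moreover have "(1 - \<beta>') * (l - m) \<le> (1 - \<beta>) * (l - m)" using b ml by (intro mult_right_mono) auto
    ultimately show False by simp
  qed
  show "u' < u" if F: "strict_mono F"
  proof -
    have "0 < (1 + q) * (u - u')" using line s[OF F] b by simp
    then show ?thesis using b by (simp add: zero_less_mult_iff)
  qed
qed

lemma equilibrium_information:
  assumes e: "equilibrium \<beta> q m c l u" and e': "equilibrium \<beta> q' m c l' u'"
    and b: "0 < \<beta>" "\<beta> < 1" "0 \<le> q" "q < q'" "q' < 1" "m < c"
  shows "l' \<le> l" "u' < u" "strict_mono F \<Longrightarrow> l' < l"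
proof -
  note E = equilibriumD[OF e] and E' = equilibriumD[OF e']
  note B = equilibrium_bounds[OF e] and B' = equilibrium_bounds[OF e']
  have lc: "l < c" "l' < c" "c < u" using B B' b by auto
  \<comment> \<open>Since \<open>u' > c\<close>, a larger \<open>q\<close> strictly raises the left
    side of the centred line equation, while its right side does not grow if \<open>l\<close> does
    not fall.\<close>
  have drop: "u' < u" if "l \<le> l'"
  proof -
    have "(1 + q) * (u' - c) < (1 + q') * (u' - c)" using B' b by (intro mult_strict_right_mono) auto
    also have "\<dots> = (1 - q') * (c - l')" by (rule E'(3))
    also have "\<dots> \<le> (1 - q) * (c - l)" using that lc b by (intro mult_mono) auto
    also have "\<dots> = (1 + q) * (u - c)" using E(3) by simp
    finally show ?thesis using b by simp
  qed
  \<comment> \<open>With \<open>\<beta>\<close> fixed, the first equation makes \<open>l\<close> an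
    increasing function of the gap.\<close>
  have foc: "l' \<le> l" if "gap l' u' \<le> gap l u"
  proof -
    have "(1 - \<beta>) * (l' - m) \<le> (1 - \<beta>) * (l - m)" using that E E' b by simp
    then show ?thesis using b by simp
  qed
  have foc': "l \<le> l'" if "gap l u \<le> gap l' u'"
  proof -
    have "(1 - \<beta>) * (l - m) \<le> (1 - \<beta>) * (l' - m)" using that E E' b by simp
    then show ?thesis using b by simp
  qed
  show ll: "l' \<le> l"
  proof (rule ccontr)
    assume n: "\<not> l' \<le> l"
    then have "u' < u" using drop by simp
    then have "gap l' u' \<le> gap l u" using n E'(1) by (intro gap_mono) auto
    then show False using n foc by simp
  qed
  \<comment> \<open>This is strict even where \<open>F\<close> is flat: if \<open>u\<close> did not
    fall, the gap would not shrink, so \<open>l\<close> would not fall, and \<open>drop\<close>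
    applies.\<close>
  show "u' < u"
  proof (rule ccontr)
    assume n: "\<not> u' < u"
    then have "gap l u \<le> gap l' u'" using ll E(1) by (intro gap_mono) auto
    then show False using n foc' drop by simp
  qed
  show "l' < l" if F: "strict_mono F"
  proof (rule ccontr)
    assume "\<not> l' < l"
    then have l: "l' = l" using ll by simp
    then have "u' < u" using drop by simp
    then have "gap l u' < gap l u" using gap_strict[OF F, of l u' u] E'(1) l by simp
    then have "\<beta> * gap l u' < \<beta> * gap l u" using b by simp
    then show False using E(2) E'(2) l by auto
  qed
qed

text \<open>A fall in \<open>l\<close> would push \<open>u\<close> up along the line and enlarge the
  gap, against the first equation. With \<open>c = c'\<close> in both directions this gives
  uniqueness; with \<open>c = r0 m / r\<close> it gives monotonicity of the thresholds in
  \<open>r\<close>.\<close>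

lemma equilibrium_mono:
  assumes e: "equilibrium \<beta> q m c l u" and e': "equilibrium \<beta> q m c' l' u'"
    and b: "0 < \<beta>" "\<beta> < 1" "0 \<le> q" "q < 1" "c \<le> c'"
  shows "l \<le> l'" "u \<le> u'"
proof -
  note E = equilibriumD[OF e] and E' = equilibriumD[OF e']
  have line: "(1 + q) * (u' - u) = 2 * (c' - c) + (1 - q) * (l - l')"
    using E(3) E'(3) by (simp add: algebra_simps)
  have up: "u \<le> u'" if "l' \<le> l"
  proof -
    have "0 \<le> (1 + q) * (u' - u)" using that line b by simp
    then show ?thesis using b by (simp add: zero_le_mult_iff)
  qed
  show ll: "l \<le> l'"
  proof (rule ccontr)
    assume n: "\<not> l \<le> l'"
    then have "gap l u \<le> gap l' u'" using up E(1) by (intro gap_mono) auto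
    then have "(1 - \<beta>) * (l - m) \<le> (1 - \<beta>) * (l' - m)" using E E' b by simp
    then show False using b n by simp
  qed
  show "u \<le> u'"
  proof (rule ccontr)
    assume n: "\<not> u \<le> u'"
    then have "gap l' u' \<le> gap l u" using ll E'(1) by (intro gap_mono) auto
    then have "(1 - \<beta>) * (l' - m) \<le> (1 - \<beta>) * (l - m)" using E E' b by simp
    then show False using b n up by simp
  qed
qed

lemma equilibrium_exists:
  assumes b: "0 < \<beta>" "\<beta> < 1" "0 \<le> q" "q < 1" "m < c"
  shows "\<exists>l u. equilibrium \<beta> q m c l u"
proof -
  \<comment> \<open>\<open>h\<close> solves the line for the upper end and \<open>\<psi>\<close> is
    the defect in the first equation. At \<open>m\<close> only the gap term is left, and at
    \<open>c\<close> the gap vanishes because \<open>h c = c\<close>; hence the sign change on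
    \<open>[m, c]\<close>.\<close>
  define h where "h l = (2 * c - (1 - q) * l) / (1 + q)" for l
  define \<psi> where "\<psi> l = (1 - \<beta>) * (l - m) - \<beta> * gap l (h l)" for l
  have h: "(1 + q) * h l + (1 - q) * l = 2 * c" for l
    using b unfolding h_def by (simp add: field_simps)
  have le_h: "l \<le> h l" if "l \<le> c" for l
    using b that unfolding h_def by (simp add: field_simps)
  have "continuous_on UNIV P"
    using primitive by (meson DERIV_isCont continuous_at_imp_continuous_on)
  then have P: "continuous_on S (\<lambda>x. P (k x))" if "continuous_on S k" for S and k :: "real \<Rightarrow> real"
    using that by (auto intro: continuous_on_compose2)
  have F: "continuous_on S (\<lambda>x. F (k x))" if "continuous_on S k" for S and k :: "real \<Rightarrow> real"
    using that continuous_F by (auto intro: continuous_on_compose2)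
  have "continuous_on {m..c} \<psi>"
    unfolding \<psi>_def gap_def h_def using b by (intro continuous_intros P F) auto
  moreover have "\<psi> m \<le> 0"
    using gap_nonneg[OF le_h[of m]] b by (simp add: \<psi>_def)
  moreover have "0 \<le> \<psi> c"
  proof -
    have "h c = c" using b by (simp add: h_def field_simps)
    then show ?thesis using b by (simp add: \<psi>_def)
  qed
  ultimately obtain l where "m \<le> l" "l \<le> c" "\<psi> l = 0"
    using IVT'[of \<psi> m 0 c] b by auto
  then have "equilibrium \<beta> q m c l (h l)"
    using h le_h by (simp add: equilibrium_def \<psi>_def)
  then show ?thesis by blast
qed

lemma equilibrium_unique:
  assumes "equilibrium \<beta> q m c l u" "equilibrium \<beta> q m c l' u'"
    and "0 < \<beta>" "\<beta> < 1" "0 \<le> q" "q < 1"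
  shows "l = l'" "u = u'"
  using equilibrium_mono[OF assms(1,2)] equilibrium_mono[OF assms(2,1)] assms(3-) by auto

lemma reflection: "smooth_convex (\<lambda>x. - F (- x)) (\<lambda>x. P (- x))"
proof
  show "mono (\<lambda>x. - F (- x))" using mono_F by (auto simp: mono_def)
  show "continuous_on UNIV (\<lambda>x. - F (- x))"
    by (intro continuous_intros continuous_on_compose2[OF continuous_F]) auto
  show "((\<lambda>x. P (- x)) has_real_derivative - F (- x)) (at x)" for x
    using primitive[of "- x"] DERIV_mirror by fastforce
qed

end

subsection \<open>Monotonicity, conditioning and measurability\<close>

lemma decreases_onI:
  assumes "\<And>s t. s \<in> S \<Longrightarrow> t \<in> S \<Longrightarrow> s < t \<Longrightarrow> h t \<le> h s"
    and "\<And>s t. strict_mono (cdf X) \<Longrightarrow> s \<in> S \<Longrightarrow> t \<in> S \<Longrightarrow> s < t \<Longrightarrow> h t < h s"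
  shows "decreases_on X S h"
  using assms by (auto simp: decreases_on_def monotone_on_def order_le_less)

lemma increases_onI:
  assumes "\<And>s t. s \<in> S \<Longrightarrow> t \<in> S \<Longrightarrow> s < t \<Longrightarrow> h s \<le> h t"
    and "\<And>s t. strict_mono (cdf X) \<Longrightarrow> s \<in> S \<Longrightarrow> t \<in> S \<Longrightarrow> s < t \<Longrightarrow> h s < h t"
  shows "increases_on X S h"
  using assms by (auto simp: increases_on_def monotone_on_def order_le_less)

lemma decreases_onD:
  assumes "decreases_on X S h" "s \<in> S" "t \<in> S" "s < t"
  shows "h t \<le> h s" "strict_mono (cdf X) \<Longrightarrow> h t < h s"
  using assms unfolding decreases_on_def monotone_on_def by auto

lemma integral_uniform_measure:
  fixes f :: "'a \<Rightarrow> real"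
  assumes "f \<in> borel_measurable M" "S \<in> sets M" "emeasure M S = ennreal p" "0 < p"
  shows "(\<integral>x. f x \<partial>uniform_measure M S) = (\<integral>x. indicator S x * f x \<partial>M) / p"
proof -
  \<comment> \<open>As \<open>p\<close> is positive and finite, the quotient in the density can be
    taken in the reals, where \<open>integral_density\<close> applies.\<close>
  have "uniform_measure M S = density M (\<lambda>x. ennreal (indicator S x / p))"
    unfolding uniform_measure_def assms(3)
    by (rule arg_cong[where f = "density M"])
      (use assms(4) in \<open>auto simp: indicator_def divide_ennreal[symmetric] fun_eq_iff\<close>)
  moreover have "(\<integral>x. f x \<partial>density M (\<lambda>x. ennreal (indicator S x / p)))
      = (\<integral>x. (indicator S x / p) * f x \<partial>M)"
    using assms by (subst integral_density) auto
  ultimately show ?thesis by simp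
qed

lemma antimono_piecewise_measurable:
  fixes h :: "real \<Rightarrow> real"
  assumes "antimono_on {0<..<a} h" "antimono_on {a<..} h"
  shows "(\<lambda>r. if 0 < r then h r else 0) \<in> borel_measurable borel"
proof -
  let ?h = "\<lambda>r. if 0 < r then h r else 0"
  have A: "?h \<in> borel_measurable (restrict_space borel I)"
    if "antimono_on I h" "I \<subseteq> {0<..}" for I
  proof -
    have "mono_on I (\<lambda>r. - h r)" using that(1) by (auto simp: monotone_on_def)
    then have "(\<lambda>r. - (- h r)) \<in> borel_measurable (restrict_space borel I)"
      using borel_measurable_mono_on_fnc borel_measurable_uminus by blast
    then show ?thesis
      by (rule measurable_cong[THEN iffD1, rotated]) (use that(2) in \<open>auto simp: space_restrict_space\<close>)
  qed
  have C: "?h \<in> borel_measurable (restrict_space borel I)"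
    if "\<And>x. x \<in> I \<Longrightarrow> ?h x = c" for I c
    by (rule measurable_cong[THEN iffD1, of _ "\<lambda>_. c"])
       (use that in \<open>auto simp: space_restrict_space\<close>)
  show ?thesis
  \<comment> \<open>The function is monotone on the first two pieces and constant on the others.
    \<open>max 0 a\<close> keeps the second piece within the positive reals when \<open>a\<close> is
    negative.\<close>
  proof (rule measurable_piecewise_restrict[of "{{0<..<a}, {max 0 a<..}, {a}, {..0}}"])
    fix I assume "I \<in> {{0<..<a}, {max 0 a<..}, {a}, {..0}}"
    then consider "I = {0<..<a}" | "I = {max 0 a<..}" | "I = {a}" | "I = {..0}" by auto
    then show "?h \<in> borel_measurable (restrict_space borel I)"
    proof cases
      case 1 then show ?thesis using assms by (intro A) auto
    next
      case 2
      have "antimono_on {max 0 a<..} h" using assms(2) by (rule monotone_on_subset) auto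
      then show ?thesis using 2 by (intro A) auto
    next
      case 3 then show ?thesis by (intro C[of _ "?h a"]) auto
    next
      case 4 then show ?thesis by (intro C[of _ 0]) auto
    qed
  qed auto
qed

text \<open>The ends are Borel on the whole line but describe the region only for
  \<open>r > 0\<close>, where thresholds have a meaning. An empty region is encoded by
  \<open>a r > b r\<close>.\<close>

definition interval_region :: "(real \<Rightarrow> real set) \<Rightarrow> bool"
  where "interval_region A \<longleftrightarrow> (\<exists>a\<in>borel_measurable borel. \<exists>b\<in>borel_measurable borel.
    \<forall>r>0. A r = {a r .. b r})"

subsection \<open>Thresholds and posterior means\<close>

text \<open>Absence of atoms is what the density of \<open>x\<close> contributes: it makes the cdf
  continuous, hence the derivative of a primitive.\<close>

locale firm = real_distribution X for X :: "real measure" +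
  fixes r0 :: real
  assumes no_atom: "measure X {x} = 0"
    and integrable_value: "integrable X (\<lambda>x. x)"
    and mean_pos: "0 < mean X"
    and r0_pos: "0 < r0"
begin

lemma continuous_cdf: "continuous_on UNIV (cdf X)"
  using isCont_cdf no_atom by (simp add: continuous_at_imp_continuous_on)

text \<open>The additive constant is arbitrary: it cancels in the increments that enter the
  gap.\<close>

definition cdf_primitive :: "real \<Rightarrow> real"
  where "cdf_primitive = (SOME P. \<forall>x. (P has_real_derivative cdf X x) (at x))"

lemma cdf_primitive: "(cdf_primitive has_real_derivative cdf X x) (at x)"
proof -
  have "\<exists>P. \<forall>x::real. -\<infinity> < ereal x \<longrightarrow> ereal x < \<infinity> \<longrightarrow> (P has_vector_derivative cdf X x) (at x)"
    by (rule einterval_antiderivative) (use isCont_cdf no_atom in auto)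
  then have "\<exists>P. \<forall>x. (P has_real_derivative cdf X x) (at x)"
    by (simp add: has_real_derivative_iff_has_vector_derivative)
  then have "\<forall>x. (cdf_primitive has_real_derivative cdf X x) (at x)"
    unfolding cdf_primitive_def by (rule someI_ex)
  then show ?thesis by blast
qed

sublocale G: smooth_convex "cdf X" cdf_primitive
  by unfold_locales (auto simp: mono_def cdf_nondecreasing continuous_cdf cdf_primitive)

sublocale H: smooth_convex "\<lambda>x. - cdf X (- x)" "\<lambda>x. cdf_primitive (- x)"
  by (rule G.reflection)

lemma has_integral_cdf:
  assumes "l \<le> u"
  shows "((\<lambda>x. cdf X x - k) has_integral (cdf_primitive u - cdf_primitive l - (u - l) * k)) {l..u}"
proof -
  have "(cdf X has_integral (cdf_primitive u - cdf_primitive l)) {l..u}"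
    using assms cdf_primitive
    by (intro fundamental_theorem_of_calculus)
       (auto simp: has_real_derivative_iff_has_vector_derivative[symmetric]
             intro: has_field_derivative_at_within)
  from has_integral_diff[OF this has_integral_const_real[of k l u]] assms
  show ?thesis by simp
qed

lemma measure_Icc: "l \<le> u \<Longrightarrow> measure X {l..u} = cdf X u - cdf X l"
proof -
  assume lu: "l \<le> u"
  have "measure X {l..u} = measure X {l} + measure X {l<..u}"
    using lu by (subst finite_measure_Union[symmetric]) (auto intro!: arg_cong[where f = "measure X"])
  then show ?thesis using lu no_atom cdf_diff_eq[of l u] by (cases "l = u") auto
qed

section \<open>From the threshold equations to equilibria of the cdf and of its reflection\<close>

lemma is_thresholds_low_iff:
  assumes "r < r0"
  shows "is_thresholds X r0 \<beta> q r (l, u) \<longleftrightarrow> G.equilibrium \<beta> q (mean X) (r0 * mean X / r) l u"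
proof (cases "l \<le> u")
  case True
  have "integral {l..u} (\<lambda>x. cdf X x - cdf X u) = - G.gap l u"
    using integral_unique[OF has_integral_cdf[OF True, of "cdf X u"]] by (simp add: G.gap_def)
  then show ?thesis
    using assms True unfolding is_thresholds_def G.equilibrium_def by (auto simp: algebra_simps)
qed (auto simp: is_thresholds_def G.equilibrium_def)

lemma is_thresholds_high_iff:
  assumes "r0 < r"
  shows "is_thresholds X r0 \<beta> q r (l, u) \<longleftrightarrow>
    H.equilibrium \<beta> q (- mean X) (- (r0 * mean X / r)) (- u) (- l)"
proof (cases "l \<le> u")
  case True
  have "integral {l..u} (\<lambda>x. cdf X x - cdf X l) = H.gap (- u) (- l)"
    using integral_unique[OF has_integral_cdf[OF True, of "cdf X l"]]
    by (simp add: H.gap_def algebra_simps)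
  then show ?thesis
    using assms True unfolding is_thresholds_def H.equilibrium_def by (auto simp: algebra_simps)
qed (auto simp: is_thresholds_def H.equilibrium_def)

lemma cutoff_low: "0 < r \<Longrightarrow> r < r0 \<Longrightarrow> mean X < r0 * mean X / r"
  using mean_pos by (simp add: field_simps)

lemma cutoff_high: "r0 < r \<Longrightarrow> - mean X < - (r0 * mean X / r)"
  using mean_pos r0_pos by (simp add: field_simps)

text \<open>Existence and uniqueness together resolve the definite description behind
  \<open>x_low\<close> and \<open>x_high\<close>.\<close>

lemma the_thresholds:
  assumes "is_thresholds X r0 \<beta> q r (l, u)"
    and "\<And>l' u'. is_thresholds X r0 \<beta> q r (l', u') \<Longrightarrow> l' = l \<and> u' = u"
  shows "x_low X r0 \<beta> q r = l" "x_high X r0 \<beta> q r = u"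
proof -
  have "(THE p. is_thresholds X r0 \<beta> q r p) = (l, u)"
  proof (rule the_equality)
    show "p = (l, u)" if "is_thresholds X r0 \<beta> q r p" for p
      using assms(2)[of "fst p" "snd p"] that by (simp add: prod_eq_iff)
  qed (rule assms(1))
  then show "x_low X r0 \<beta> q r = l" "x_high X r0 \<beta> q r = u"
    by (simp_all add: x_low_def x_high_def)
qed

lemma equilibrium_low:
  assumes "0 < \<beta>" "\<beta> < 1" "0 \<le> q" "q < 1" "0 < r" "r < r0"
  shows "G.equilibrium \<beta> q (mean X) (r0 * mean X / r) (x_low X r0 \<beta> q r) (x_high X r0 \<beta> q r)"
proof -
  obtain l u where e: "G.equilibrium \<beta> q (mean X) (r0 * mean X / r) l u"
    using G.equilibrium_exists[OF assms(1-4) cutoff_low[OF assms(5,6)]] by blast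
  have "l' = l \<and> u' = u" if "is_thresholds X r0 \<beta> q r (l', u')" for l' u'
    using G.equilibrium_unique[OF _ e assms(1-4), of l' u'] that
    by (simp add: is_thresholds_low_iff[OF assms(6)])
  from the_thresholds[OF is_thresholds_low_iff[OF assms(6), THEN iffD2, OF e] this]
  show ?thesis using e by simp
qed

lemma equilibrium_high:
  assumes "0 < \<beta>" "\<beta> < 1" "0 \<le> q" "q < 1" "r0 < r"
  shows "H.equilibrium \<beta> q (- mean X) (- (r0 * mean X / r)) (- x_high X r0 \<beta> q r) (- x_low X r0 \<beta> q r)"
proof -
  obtain l u where e: "H.equilibrium \<beta> q (- mean X) (- (r0 * mean X / r)) l u"
    using H.equilibrium_exists[OF assms(1-4) cutoff_high[OF assms(5)]] by blast
  have T: "is_thresholds X r0 \<beta> q r (- u, - l)"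
    using e by (simp add: is_thresholds_high_iff[OF assms(5)])
  have "l' = - u \<and> u' = - l" if "is_thresholds X r0 \<beta> q r (l', u')" for l' u'
    using H.equilibrium_unique[OF _ e assms(1-4), of "- u'" "- l'"] that
    by (simp add: is_thresholds_high_iff[OF assms(5)])
  from the_thresholds[OF T this]
  show ?thesis using e by simp
qed

lemma cutoff_between:
  assumes "0 < \<beta>" "\<beta> < 1" "0 \<le> q" "q < 1" "0 < r" "r \<noteq> r0"
  shows "x_low X r0 \<beta> q r < r0 * mean X / r" "r0 * mean X / r < x_high X r0 \<beta> q r"
proof -
  have "x_low X r0 \<beta> q r < r0 * mean X / r \<and> r0 * mean X / r < x_high X r0 \<beta> q r"
  proof (cases "r < r0")
    case True
    then show ?thesis
      using G.equilibrium_bounds(2,3)[OF equilibrium_low[of \<beta> q r]] cutoff_low[of r] assms by simp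
  next
    case False
    then show ?thesis
      using H.equilibrium_bounds(2,3)[OF equilibrium_high[of \<beta> q r]] cutoff_high[of r] assms by simp
  qed
  then show "x_low X r0 \<beta> q r < r0 * mean X / r" "r0 * mean X / r < x_high X r0 \<beta> q r" by auto
qed

text \<open>Competence shrinks the withholding interval from both ends. Reflection swaps the ends
  and keeps the shrinking, so both regimes give the same inequalities. Information instead shifts
  the interval, downwards for \<open>r < r0\<close> and upwards for \<open>r > r0\<close>.\<close>

lemma thresholds_competence:
  assumes "0 < \<beta>" "\<beta> < \<beta>'" "\<beta>' < 1" "0 \<le> q" "q < 1" "0 < r" "r \<noteq> r0"
  shows "x_low X r0 \<beta> q r \<le> x_low X r0 \<beta>' q r" "x_high X r0 \<beta>' q r \<le> x_high X r0 \<beta> q r"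
    and "strict_mono (cdf X) \<Longrightarrow> x_low X r0 \<beta> q r < x_low X r0 \<beta>' q r"
    and "strict_mono (cdf X) \<Longrightarrow> x_high X r0 \<beta>' q r < x_high X r0 \<beta> q r"
proof -
  have refl: "strict_mono (\<lambda>x. - cdf X (- x))" if "strict_mono (cdf X)"
    using that by (auto simp: strict_mono_def)
  have "x_low X r0 \<beta> q r \<le> x_low X r0 \<beta>' q r \<and> x_high X r0 \<beta>' q r \<le> x_high X r0 \<beta> q r \<and>
    (strict_mono (cdf X) \<longrightarrow> x_low X r0 \<beta> q r < x_low X r0 \<beta>' q r \<and>
      x_high X r0 \<beta>' q r < x_high X r0 \<beta> q r)"
  proof (cases "r < r0")
    case True
    show ?thesis
      using G.equilibrium_competence[OF equilibrium_low[of \<beta> q r] equilibrium_low[of \<beta>' q r]]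
        cutoff_low[of r] True assms by simp
  next
    case False
    show ?thesis
      using H.equilibrium_competence[OF equilibrium_high[of \<beta> q r] equilibrium_high[of \<beta>' q r]]
        cutoff_high[of r] False refl assms by simp
  qed
  then show "x_low X r0 \<beta> q r \<le> x_low X r0 \<beta>' q r" "x_high X r0 \<beta>' q r \<le> x_high X r0 \<beta> q r"
    and "strict_mono (cdf X) \<Longrightarrow> x_low X r0 \<beta> q r < x_low X r0 \<beta>' q r"
    and "strict_mono (cdf X) \<Longrightarrow> x_high X r0 \<beta>' q r < x_high X r0 \<beta> q r" by auto
qed

lemma thresholds_information_low:
  assumes "0 < \<beta>" "\<beta> < 1" "0 \<le> q" "q < q'" "q' < 1" "0 < r" "r < r0"
  shows "x_low X r0 \<beta> q' r \<le> x_low X r0 \<beta> q r" "x_high X r0 \<beta> q' r < x_high X r0 \<beta> q r"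
    and "strict_mono (cdf X) \<Longrightarrow> x_low X r0 \<beta> q' r < x_low X r0 \<beta> q r"
  using G.equilibrium_information[OF equilibrium_low[of \<beta> q r] equilibrium_low[of \<beta> q' r]]
    cutoff_low[of r] assms by simp_all

lemma thresholds_information_high:
  assumes "0 < \<beta>" "\<beta> < 1" "0 \<le> q" "q < q'" "q' < 1" "r0 < r"
  shows "x_high X r0 \<beta> q r \<le> x_high X r0 \<beta> q' r" "x_low X r0 \<beta> q r < x_low X r0 \<beta> q' r"
    and "strict_mono (cdf X) \<Longrightarrow> x_high X r0 \<beta> q r < x_high X r0 \<beta> q' r"
proof -
  have refl: "strict_mono (\<lambda>x. - cdf X (- x))" if "strict_mono (cdf X)"
    using that by (auto simp: strict_mono_def)
  show "x_high X r0 \<beta> q r \<le> x_high X r0 \<beta> q' r" "x_low X r0 \<beta> q r < x_low X r0 \<beta> q' r"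
    and "strict_mono (cdf X) \<Longrightarrow> x_high X r0 \<beta> q r < x_high X r0 \<beta> q' r"
    using H.equilibrium_information[OF equilibrium_high[of \<beta> q r] equilibrium_high[of \<beta> q' r]]
      cutoff_high[of r] refl assms by simp_all
qed

text \<open>The break-even value \<open>r0 m / r\<close> falls as \<open>r\<close> grows. The two
  sides of \<open>r0\<close> are kept apart because the equations change there.\<close>

lemma thresholds_antimono:
  assumes "0 < \<beta>" "\<beta> < 1" "0 \<le> q" "q < 1"
  shows "antimono_on {0<..<r0} (x_low X r0 \<beta> q)" "antimono_on {r0<..} (x_low X r0 \<beta> q)"
    and "antimono_on {0<..<r0} (x_high X r0 \<beta> q)" "antimono_on {r0<..} (x_high X r0 \<beta> q)"
proof -
  have c: "r0 * mean X / s \<le> r0 * mean X / r" if "0 < r" "r \<le> s" for r s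
    using that mean_pos r0_pos by (intro divide_left_mono) auto
  have low: "x_low X r0 \<beta> q s \<le> x_low X r0 \<beta> q r \<and> x_high X r0 \<beta> q s \<le> x_high X r0 \<beta> q r"
    if "0 < r" "r \<le> s" "s < r0" for r s
    using G.equilibrium_mono[OF equilibrium_low[of \<beta> q s] equilibrium_low[of \<beta> q r]] c that assms
    by simp
  have high: "x_low X r0 \<beta> q s \<le> x_low X r0 \<beta> q r \<and> x_high X r0 \<beta> q s \<le> x_high X r0 \<beta> q r"
    if "r0 < r" "r \<le> s" for r s
    using H.equilibrium_mono[OF equilibrium_high[of \<beta> q r] equilibrium_high[of \<beta> q s]] 
      c[of r s] r0_pos that assms
    by simp
  show "antimono_on {0<..<r0} (x_low X r0 \<beta> q)" "antimono_on {r0<..} (x_low X r0 \<beta> q)"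
    and "antimono_on {0<..<r0} (x_high X r0 \<beta> q)" "antimono_on {r0<..} (x_high X r0 \<beta> q)"
    using low high by (auto simp: monotone_on_def)
qed

lemma thresholds_measurable:
  assumes "0 < \<beta>" "\<beta> < 1" "0 \<le> q" "q < 1"
  shows "(\<lambda>r. if 0 < r then x_low X r0 \<beta> q r else 0) \<in> borel_measurable borel"
    and "(\<lambda>r. if 0 < r then x_high X r0 \<beta> q r else 0) \<in> borel_measurable borel"
  by (rule antimono_piecewise_measurable[OF thresholds_antimono(1,2)[OF assms]]
      antimono_piecewise_measurable[OF thresholds_antimono(3,4)[OF assms]])+

section \<open>The posterior mean and the price reaction\<close>

lemma integrable_above_low: "integrable X (\<lambda>x. indicator {l..u} x * (x - l))"
  by (rule integrable_const_bound[of _ "\<bar>u - l\<bar>"]) (auto simp: indicator_def)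

text \<open>Fubini: \<open>x - l\<close> is the length of the set of \<open>t\<close> with \<open>l \<le> t < x\<close>.\<close>

lemma expectation_above_low:
  assumes "l \<le> u"
  shows "(\<integral>x. indicator {l..u} x * (x - l) \<partial>X) = G.gap l u"
proof -
  interpret XL: pair_sigma_finite X lborel ..
  \<comment> \<open>The triangle under the diagonal: its slice at \<open>x\<close> has length
    \<open>x - l\<close>, and its slice at \<open>t\<close> is \<open>{t<..u}\<close>, of mass
    \<open>cdf X u - cdf X t\<close>.\<close>
  let ?I = "\<lambda>x t. indicator {p::real\<times>real. l \<le> snd p \<and> snd p < fst p \<and> fst p \<le> u} (x, t) :: ennreal"
  have meas: "(\<lambda>(x, t). ?I x t) \<in> borel_measurable (X \<Otimes>\<^sub>M lborel)"
    by (simp add: case_prod_beta) measurable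
  have inner1: "(\<integral>\<^sup>+t. ?I x t \<partial>lborel) = ennreal (indicator {l..u} x * (x - l))" for x
  proof (cases "l \<le> x \<and> x \<le> u")
    case True
    have "(\<integral>\<^sup>+t. ?I x t \<partial>lborel) = (\<integral>\<^sup>+t. indicator {l..<x} t \<partial>lborel)"
      using True by (intro nn_integral_cong) (auto simp: indicator_def)
    then show ?thesis using True by simp
  next
    case False
    then have "?I x t = 0" for t by (auto simp: indicator_def)
    then show ?thesis using False by auto
  qed
  have inner2: "(\<integral>\<^sup>+x. ?I x t \<partial>X) = ennreal (cdf X u - cdf X t) * indicator {l..u} t" for t
  proof (cases "l \<le> t \<and> t \<le> u")
    case True
    have "(\<integral>\<^sup>+x. ?I x t \<partial>X) = (\<integral>\<^sup>+x. indicator {t<..u} x \<partial>X)"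
      using True by (intro nn_integral_cong) (auto simp: indicator_def)
    also have "\<dots> = ennreal (cdf X u - cdf X t)"
      using True by (cases "t = u") (auto simp: emeasure_eq_measure cdf_diff_eq)
    finally show ?thesis using True by simp
  next
    case False
    then have "?I x t = 0" for x by (auto simp: indicator_def)
    then show ?thesis using False by auto
  qed
  have "ennreal (\<integral>x. indicator {l..u} x * (x - l) \<partial>X) = (\<integral>\<^sup>+x. ennreal (indicator {l..u} x * (x - l)) \<partial>X)"
    by (rule nn_integral_eq_integral[symmetric, OF integrable_above_low]) (auto simp: indicator_def)
  also have "\<dots> = (\<integral>\<^sup>+t. (\<integral>\<^sup>+x. ?I x t \<partial>X) \<partial>lborel)"
    using XL.Fubini'[OF meas] by (simp add: inner1)
  also have "\<dots> = (\<integral>\<^sup>+t. ennreal (cdf X u - cdf X t) * indicator {l..u} t \<partial>lborel)"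
    by (simp add: inner2)
  also have "\<dots> = ennreal ((u * cdf X u - cdf_primitive u) - (l * cdf X u - cdf_primitive l))"
  proof (rule nn_integral_FTC_Icc)
    show "(\<lambda>t. cdf X u - cdf X t) \<in> borel_measurable borel"
      by (intro borel_measurable_continuous_onI continuous_intros continuous_cdf)
    show "((\<lambda>t. t * cdf X u - cdf_primitive t) has_real_derivative cdf X u - cdf X t) (at t)" for t
      by (auto intro!: derivative_eq_intros cdf_primitive)
  qed (use assms in \<open>auto simp: cdf_nondecreasing\<close>)
  finally have "ennreal (\<integral>x. indicator {l..u} x * (x - l) \<partial>X) = ennreal (G.gap l u)"
    by (simp add: G.gap_def algebra_simps)
  moreover have "0 \<le> (\<integral>x. indicator {l..u} x * (x - l) \<partial>X)"
    by (rule integral_nonneg_AE) (auto simp: indicator_def)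
  ultimately show ?thesis using G.gap_nonneg[OF assms] by simp
qed

lemma expectation_Icc:
  assumes "l \<le> u"
  shows "(\<integral>x. indicator {l..u} x * x \<partial>X) = l * (cdf X u - cdf X l) + G.gap l u"
    and "(\<integral>x. indicator {l..u} x * x \<partial>X) = u * (cdf X u - cdf X l) - H.gap (- u) (- l)"
proof -
  have "(\<integral>x. indicator {l..u} x * x \<partial>X)
      = (\<integral>x. l * indicator {l..u} x + indicator {l..u} x * (x - l) \<partial>X)"
    by (rule Bochner_Integration.integral_cong) (auto simp: indicator_def)
  also have "\<dots> = (\<integral>x. l * indicator {l..u} x \<partial>X) + (\<integral>x. indicator {l..u} x * (x - l) \<partial>X)"
    by (intro Bochner_Integration.integral_add integrable_above_low
        integrable_const_bound[of _ "\<bar>l\<bar>"]) (auto simp: indicator_def)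
  finally show low: "(\<integral>x. indicator {l..u} x * x \<partial>X) = l * (cdf X u - cdf X l) + G.gap l u"
    using assms by (simp add: expectation_above_low measure_Icc)
  \<comment> \<open>The gap and its reflected counterpart tile a rectangle: they add up to
    \<open>(u - l) * (cdf X u - cdf X l)\<close>.\<close>
  show "(\<integral>x. indicator {l..u} x * x \<partial>X) = u * (cdf X u - cdf X l) - H.gap (- u) (- l)"
    unfolding low G.gap_def H.gap_def by (simp add: algebra_simps)
qed

text \<open>Bayes' rule by splitting on whether the investor is informed. An uninformed investor
  always issues a simple report and so contributes the prior mean with weight
  \<open>1 - \<beta>\<close>, which also keeps the denominator positive.\<close>

lemma posterior_mean:
  assumes "0 < \<beta>" "\<beta> < 1" "l \<le> u"
  shows "(\<integral>\<omega>. snd \<omega> \<partial>uniform_measure (measure_pmf (bernoulli_pmf \<beta>) \<Otimes>\<^sub>M X) (simple_report l u))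
    = ((1 - \<beta>) * mean X + \<beta> * (\<integral>x. indicator {l..u} x * x \<partial>X))
      / ((1 - \<beta>) + \<beta> * (cdf X u - cdf X l))"
proof -
  let ?B = "measure_pmf (bernoulli_pmf \<beta>)"
  interpret BX: pair_prob_space ?B X ..
  have S_eq: "simple_report l u = {\<omega> \<in> space (?B \<Otimes>\<^sub>M X). fst \<omega> \<longrightarrow> snd \<omega> \<in> {l..u}}"
    by (auto simp: simple_report_def space_pair_measure)
  have S: "simple_report l u \<in> sets (?B \<Otimes>\<^sub>M X)"
    unfolding S_eq by measurable
  have mono: "cdf X l \<le> cdf X u" using assms(3) by (rule cdf_nondecreasing)
  have "emeasure (?B \<Otimes>\<^sub>M X) (simple_report l u) = (\<integral>\<^sup>+b. emeasure X (Pair b -` simple_report l u) \<partial>?B)"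
    by (rule emeasure_pair_measure_alt[OF S])
  also have "\<dots> = ennreal ((1 - \<beta>) + \<beta> * (cdf X u - cdf X l))"
  proof -
    have "Pair True -` simple_report l u = {l..u}" "Pair False -` simple_report l u = UNIV"
      by (auto simp: simple_report_def)
    then show ?thesis
      using assms mono prob_space by (simp add: emeasure_eq_measure measure_Icc ennreal_mult[symmetric]
          ennreal_plus[symmetric] algebra_simps del: ennreal_plus)
  qed
  finally have em: "emeasure (?B \<Otimes>\<^sub>M X) (simple_report l u)
      = ennreal ((1 - \<beta>) + \<beta> * (cdf X u - cdf X l))" .
  have pos: "0 < (1 - \<beta>) + \<beta> * (cdf X u - cdf X l)"
    using assms mono by (simp add: add_pos_nonneg)
  have "integrable (?B \<Otimes>\<^sub>M X) (\<lambda>\<omega>. snd \<omega>)"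
  proof (rule BX.Fubini_integrable)
    show "integrable ?B (\<lambda>b. \<integral>x. norm (snd (b, x)) \<partial>X)" by simp
    show "AE b in ?B. integrable X (\<lambda>x. snd (b, x))" using integrable_value by simp
  qed simp
  then have "integrable (?B \<Otimes>\<^sub>M X) (\<lambda>\<omega>. indicator (simple_report l u) \<omega> * snd \<omega>)"
    using integrable_mult_indicator[OF S] by fastforce
  then have "(\<integral>\<omega>. indicator (simple_report l u) \<omega> * snd \<omega> \<partial>(?B \<Otimes>\<^sub>M X))
      = (\<integral>b. (\<integral>x. indicator (simple_report l u) (b, x) * x \<partial>X) \<partial>?B)"
    using BX.integral_fst'[of "\<lambda>\<omega>. indicator (simple_report l u) \<omega> * snd \<omega>"] by simp
  also have "\<dots> = (1 - \<beta>) * mean X + \<beta> * (\<integral>x. indicator {l..u} x * x \<partial>X)"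
  proof -
    have "indicator (simple_report l u) (True, x) = (indicator {l..u} x :: real)"
      "indicator (simple_report l u) (False, x) = (1 :: real)" for x
      by (auto simp: simple_report_def indicator_def)
    then show ?thesis using assms by (simp add: mean_def)
  qed
  finally show ?thesis
    using integral_uniform_measure[OF _ S em pos, of snd] by simp
qed

lemma mu_ND_low:
  assumes "0 < \<beta>" "\<beta> < 1" "0 \<le> q" "q < 1" "0 < r" "r < r0"
  shows "mu_ND X r0 \<beta> q r = x_low X r0 \<beta> q r"
proof -
  let ?l = "x_low X r0 \<beta> q r" and ?u = "x_high X r0 \<beta> q r"
  note E = G.equilibriumD[OF equilibrium_low[OF assms]]
  have pos: "0 < (1 - \<beta>) + \<beta> * (cdf X ?u - cdf X ?l)"
    using assms cdf_nondecreasing[OF E(1)] by (simp add: add_pos_nonneg)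
  \<comment> \<open>By \<open>E(2)\<close> the gap term equals
    \<open>(1 - \<beta>) * (?l - mean X)\<close>, so the prior mean cancels and \<open>?l\<close>
    factors out.\<close>
  have "(1 - \<beta>) * mean X + \<beta> * (\<integral>x. indicator {?l..?u} x * x \<partial>X)
      = ?l * ((1 - \<beta>) + \<beta> * (cdf X ?u - cdf X ?l))"
    using E(2) unfolding expectation_Icc(1)[OF E(1)] by (simp add: algebra_simps)
  then show ?thesis
    using pos unfolding mu_ND_def posterior_mean[OF assms(1,2) E(1)] by simp
qed

lemma mu_ND_high:
  assumes "0 < \<beta>" "\<beta> < 1" "0 \<le> q" "q < 1" "r0 < r"
  shows "mu_ND X r0 \<beta> q r = x_high X r0 \<beta> q r"
proof -
  let ?l = "x_low X r0 \<beta> q r" and ?u = "x_high X r0 \<beta> q r"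
  note E = H.equilibriumD[OF equilibrium_high[OF assms]]
  have lu: "?l \<le> ?u" using E(1) by simp
  have pos: "0 < (1 - \<beta>) + \<beta> * (cdf X ?u - cdf X ?l)"
    using assms cdf_nondecreasing[OF lu] by (simp add: add_pos_nonneg)
  have "(1 - \<beta>) * mean X + \<beta> * (\<integral>x. indicator {?l..?u} x * x \<partial>X)
      = ?u * ((1 - \<beta>) + \<beta> * (cdf X ?u - cdf X ?l))"
    using E(2) unfolding expectation_Icc(2)[OF lu] by (simp add: algebra_simps)
  then show ?thesis
    using pos unfolding mu_ND_def posterior_mean[OF assms(1,2) lu] by simp
qed

text \<open>The posterior mean lies below the break-even value, so the price falls; this settles the
  sign inside the absolute value.\<close>

lemma price_reaction_low:
  assumes "0 < \<beta>" "\<beta> < 1" "0 \<le> q" "q < 1" "0 < r" "r < r0"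
  shows "price_reaction X r0 \<beta> q r = r0 * mean X - r * x_low X r0 \<beta> q r"
  using cutoff_between(1)[of \<beta> q r] assms
  unfolding price_reaction_def mu_ND_low[OF assms] by (simp add: field_simps)

lemma price_reaction_high:
  assumes "0 < \<beta>" "\<beta> < 1" "0 \<le> q" "q < 1" "r0 < r"
  shows "price_reaction X r0 \<beta> q r = r * x_high X r0 \<beta> q r - r0 * mean X"
  using cutoff_between(2)[of \<beta> q r] r0_pos assms
  unfolding price_reaction_def mu_ND_high[OF assms] by (simp add: field_simps)

subsection \<open>Comparative statics\<close>

lemma measure_Icc_mono:
  assumes "a' \<le> a" "a \<le> b" "b \<le> b'"
  shows "measure X {a..b} \<le> measure X {a'..b'}"
  using assms by (intro finite_measure_mono) auto

lemma measure_Icc_strict: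
  assumes "strict_mono (cdf X)" "a' \<le> a" "a \<le> b" "b \<le> b'" "a' < a \<or> b < b'"
  shows "measure X {a..b} < measure X {a'..b'}"
proof -
  have "cdf X a' \<le> cdf X a" "cdf X b \<le> cdf X b'" using assms by (auto intro: cdf_nondecreasing)
  moreover have "cdf X a' < cdf X a \<or> cdf X b < cdf X b'" using assms by (auto simp: strict_mono_def)
  ultimately show ?thesis using assms by (auto simp: measure_Icc)
qed

text \<open>Independence lets the product measure be computed by slices at fixed \<open>r\<close>.
  Continuity of the cdf and measurable ends make the slice probability measurable in
  \<open>r\<close>.\<close>

lemma ex_ante_prob_eq:
  assumes R: "real_distribution R" "AE r in R. 0 < r" and A: "interval_region A"
  shows "integrable R (\<lambda>r. if 0 < r then measure X (A r) else 0)"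
    and "ex_ante_prob R X A = (\<integral>r. (if 0 < r then measure X (A r) else 0) \<partial>R)"
proof -
  interpret R: real_distribution R by fact
  obtain a b where [measurable]: "a \<in> borel_measurable borel" "b \<in> borel_measurable borel"
    and ab: "\<And>r. 0 < r \<Longrightarrow> A r = {a r .. b r}"
    using A unfolding interval_region_def by blast
  let ?h = "\<lambda>r. if 0 < r then measure X (A r) else 0"
  have [measurable]: "cdf X \<in> borel_measurable borel"
    by (intro borel_measurable_continuous_onI continuous_cdf)
  have "?h = (\<lambda>r. if 0 < r \<and> a r \<le> b r then cdf X (b r) - cdf X (a r) else 0)"
    using ab by (auto simp: measure_Icc fun_eq_iff)
  then have "?h \<in> borel_measurable R" by simp
  then show int: "integrable R ?h"
    by (intro R.integrable_const_bound[of _ 1]) auto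
  have "{(r, x). 0 < r \<and> x \<in> A r} = {p \<in> space (R \<Otimes>\<^sub>M X). 0 < fst p \<and> a (fst p) \<le> snd p \<and> snd p \<le> b (fst p)}"
    using ab by (auto simp: space_pair_measure)
  also have "\<dots> \<in> sets (R \<Otimes>\<^sub>M X)" by measurable
  finally have S: "{(r, x). 0 < r \<and> x \<in> A r} \<in> sets (R \<Otimes>\<^sub>M X)" .
  have "emeasure (R \<Otimes>\<^sub>M X) {(r, x). 0 < r \<and> x \<in> A r}
      = (\<integral>\<^sup>+r. emeasure X (Pair r -` {(r, x). 0 < r \<and> x \<in> A r}) \<partial>R)"
    by (rule emeasure_pair_measure_alt[OF S])
  also have "\<dots> = (\<integral>\<^sup>+r. ennreal (?h r) \<partial>R)"
    by (intro nn_integral_cong) (auto simp: emeasure_eq_measure vimage_def)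
  also have "\<dots> = ennreal (\<integral>r. ?h r \<partial>R)"
    by (rule nn_integral_eq_integral[OF int]) simp
  finally show "ex_ante_prob R X A = (\<integral>r. ?h r \<partial>R)"
    unfolding ex_ante_prob_def measure_def by (simp add: enn2real_ennreal)
qed

text \<open>Monotonicity at each \<open>r\<close> is integrated over \<open>r\<close>. Strictness
  survives because it holds almost surely on a probability space; it relies on \<open>0 < r\<close>,
  since both integrands are zero elsewhere.\<close>

lemma ex_ante_decreases:
  assumes R: "real_distribution R" "AE r in R. 0 < r" "AE r in R. r \<noteq> r0"
    and A: "\<And>t. t \<in> S \<Longrightarrow> interval_region (A t)"
    and mono: "\<And>r. 0 < r \<Longrightarrow> r \<noteq> r0 \<Longrightarrow> decreases_on X S (\<lambda>t. measure X (A t r))"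
  shows "decreases_on X S (\<lambda>t. ex_ante_prob R X (A t))"
proof (rule decreases_onI)
  interpret R: real_distribution R by fact
  fix s t assume st: "s \<in> S" "t \<in> S" "s < t"
  note eq = ex_ante_prob_eq[OF R(1,2) A]
  have "AE r in R. (if 0 < r then measure X (A t r) else 0) \<le> (if 0 < r then measure X (A s r) else 0)"
    using R(3) by eventually_elim (use decreases_onD[OF mono st] in auto)
  then show "ex_ante_prob R X (A t) \<le> ex_ante_prob R X (A s)"
    unfolding eq(2)[OF st(1)] eq(2)[OF st(2)] by (intro integral_mono_AE eq(1) st)
  assume strict: "strict_mono (cdf X)"
  have "AE r in R. (if 0 < r then measure X (A t r) else 0) < (if 0 < r then measure X (A s r) else 0)"
    using R(2,3) by eventually_elim (use decreases_onD[OF mono st] strict in auto)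
  then show "ex_ante_prob R X (A t) < ex_ante_prob R X (A s)"
    unfolding eq(2)[OF st(1)] eq(2)[OF st(2)]
    by (intro R.integral_less_AE_space eq(1) st) (simp_all add: R.emeasure_space_1[simplified])
qed

lemma interval_regions:
  assumes "0 < \<beta>" "\<beta> < 1" "0 \<le> q" "q < 1"
  shows "interval_region (negative_region X r0 \<beta> q)" "interval_region (positive_region X r0 \<beta> q)"
    and "interval_region (overall_region X r0 \<beta> q)" "interval_region (misleading_region X r0 \<beta> q)"
proof -
  define l where "l r = (if 0 < r then x_low X r0 \<beta> q r else 0)" for r
  define u where "u r = (if 0 < r then x_high X r0 \<beta> q r else 0)" for r
  have [measurable]: "l \<in> borel_measurable borel" "u \<in> borel_measurable borel"
    unfolding l_def u_def by (rule thresholds_measurable[OF assms])+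
  have I: "interval_region A" if "a \<in> borel_measurable borel" "b \<in> borel_measurable borel"
    "\<And>r. 0 < r \<Longrightarrow> A r = {a r .. b r}" for a b A
    using that unfolding interval_region_def by blast
  show "interval_region (negative_region X r0 \<beta> q)"
    by (rule I[of l "\<lambda>r. r0 * mean X / r"]) (auto simp: negative_region_def l_def)
  show "interval_region (positive_region X r0 \<beta> q)"
    by (rule I[of "\<lambda>r. r0 * mean X / r" u]) (auto simp: positive_region_def u_def)
  show "interval_region (overall_region X r0 \<beta> q)"
    by (rule I[of l u]) (auto simp: overall_region_def l_def u_def)
  show "interval_region (misleading_region X r0 \<beta> q)"
    \<comment> \<open>The values 1 and 0 at \<open>r = r0\<close> produce an empty interval,
      matching the empty misleading region there.\<close>
    by (rule I[of "\<lambda>r. if r < r0 then r0 * mean X / r else if r0 < r then l r else 1"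
          "\<lambda>r. if r < r0 then u r else if r0 < r then r0 * mean X / r else 0"])
       (auto simp: misleading_region_def l_def u_def)
qed


section \<open>Dependence of the regions and of the price reaction on competence and
  information\<close>

lemma regions_decrease_competence:
  assumes "0 \<le> q" "q < 1" "0 < r" "r \<noteq> r0"
    and "A \<in> {negative_region, positive_region, overall_region, misleading_region}"
  shows "decreases_on X {0<..<1} (\<lambda>\<beta>. measure X (A X r0 \<beta> q r))"
proof (rule decreases_onI)
  fix \<beta> \<beta>' :: real assume b: "\<beta> \<in> {0<..<1}" "\<beta>' \<in> {0<..<1}" "\<beta> < \<beta>'"
  \<comment> \<open>Each region ends at thresholds or at the break-even value, which does not depend
    on \<open>\<beta>\<close>, so all of them shrink.\<close>
  have T: "x_low X r0 \<beta> q r \<le> x_low X r0 \<beta>' q r" "x_high X r0 \<beta>' q r \<le> x_high X r0 \<beta> q r"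
    "x_low X r0 \<beta>' q r < r0 * mean X / r" "r0 * mean X / r < x_high X r0 \<beta>' q r"
    using b assms by (auto intro!: thresholds_competence cutoff_between)
  show "measure X (A X r0 \<beta>' q r) \<le> measure X (A X r0 \<beta> q r)"
    using assms T
    by (auto simp: negative_region_def positive_region_def overall_region_def misleading_region_def
        intro!: measure_Icc_mono)
  assume s: "strict_mono (cdf X)"
  have "x_low X r0 \<beta> q r < x_low X r0 \<beta>' q r" "x_high X r0 \<beta>' q r < x_high X r0 \<beta> q r"
    using b assms s by (auto intro!: thresholds_competence)
  then show "measure X (A X r0 \<beta>' q r) < measure X (A X r0 \<beta> q r)"
    using assms T
    by (auto simp: negative_region_def positive_region_def overall_region_def misleading_region_def
        intro!: measure_Icc_strict[OF s])
qed

lemma price_reaction_decreases_competence: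
  assumes "0 \<le> q" "q < 1" "0 < r" "r \<noteq> r0"
  shows "decreases_on X {0<..<1} (\<lambda>\<beta>. price_reaction X r0 \<beta> q r)"
proof (cases "r < r0")
  case True
  show ?thesis
  proof (rule decreases_onI)
    fix \<beta> \<beta>' :: real assume b: "\<beta> \<in> {0<..<1}" "\<beta>' \<in> {0<..<1}" "\<beta> < \<beta>'"
    show "price_reaction X r0 \<beta>' q r \<le> price_reaction X r0 \<beta> q r"
      using b True assms by (simp add: price_reaction_low thresholds_competence)
    show "price_reaction X r0 \<beta>' q r < price_reaction X r0 \<beta> q r" if "strict_mono (cdf X)"
      using that b True assms by (simp add: price_reaction_low thresholds_competence)
  qed
next
  case False
  show ?thesis
  proof (rule decreases_onI)
    fix \<beta> \<beta>' :: real assume b: "\<beta> \<in> {0<..<1}" "\<beta>' \<in> {0<..<1}" "\<beta> < \<beta>'"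
    show "price_reaction X r0 \<beta>' q r \<le> price_reaction X r0 \<beta> q r"
      using b False assms by (simp add: price_reaction_high thresholds_competence)
    show "price_reaction X r0 \<beta>' q r < price_reaction X r0 \<beta> q r" if "strict_mono (cdf X)"
      using that b False assms by (simp add: price_reaction_high thresholds_competence)
  qed
qed

lemma price_reaction_increases_information:
  assumes "0 < \<beta>" "\<beta> < 1" "0 < r" "r \<noteq> r0"
  shows "increases_on X {0..<1} (\<lambda>q. price_reaction X r0 \<beta> q r)"
proof (cases "r < r0")
  case True
  show ?thesis
  proof (rule increases_onI)
    fix q q' :: real assume b: "q \<in> {0..<1}" "q' \<in> {0..<1}" "q < q'"
    show "price_reaction X r0 \<beta> q r \<le> price_reaction X r0 \<beta> q' r"
      using b True assms by (simp add: price_reaction_low thresholds_information_low)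
    show "price_reaction X r0 \<beta> q r < price_reaction X r0 \<beta> q' r" if "strict_mono (cdf X)"
      using that b True assms by (simp add: price_reaction_low thresholds_information_low)
  qed
next
  case False
  show ?thesis
  proof (rule increases_onI)
    fix q q' :: real assume b: "q \<in> {0..<1}" "q' \<in> {0..<1}" "q < q'"
    show "price_reaction X r0 \<beta> q r \<le> price_reaction X r0 \<beta> q' r"
      using b False assms by (simp add: price_reaction_high thresholds_information_high)
    show "price_reaction X r0 \<beta> q r < price_reaction X r0 \<beta> q' r" if "strict_mono (cdf X)"
      using that b False assms by (simp add: price_reaction_high thresholds_information_high)
  qed
qed

text \<open>The interval moves down past the fixed break-even value: the part below it gains and the
  part above it loses.\<close>

lemma information_low:
  assumes "0 < \<beta>" "\<beta> < 1" "0 < r" "r < r0"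
  shows "increases_on X {0..<1} (\<lambda>q. measure X (negative_region X r0 \<beta> q r))"
    and "decreases_on X {0..<1} (\<lambda>q. measure X (positive_region X r0 \<beta> q r))"
proof -
  have T: "x_low X r0 \<beta> q' r \<le> x_low X r0 \<beta> q r" "x_high X r0 \<beta> q' r < x_high X r0 \<beta> q r"
    "x_low X r0 \<beta> q r < r0 * mean X / r" "r0 * mean X / r < x_high X r0 \<beta> q' r"
    "strict_mono (cdf X) \<Longrightarrow> x_low X r0 \<beta> q' r < x_low X r0 \<beta> q r"
    if "q \<in> {0..<1}" "q' \<in> {0..<1}" "q < q'" for q q'
    using that assms by (auto intro!: thresholds_information_low cutoff_between)
  show "increases_on X {0..<1} (\<lambda>q. measure X (negative_region X r0 \<beta> q r))"
    unfolding negative_region_def using T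
    by (intro increases_onI measure_Icc_mono measure_Icc_strict disjI1) (auto simp: less_imp_le)
  show "decreases_on X {0..<1} (\<lambda>q. measure X (positive_region X r0 \<beta> q r))"
    unfolding positive_region_def using T
    by (intro decreases_onI measure_Icc_mono measure_Icc_strict disjI2) (auto simp: less_imp_le)
qed

lemma information_high:
  assumes "0 < \<beta>" "\<beta> < 1" "r0 < r"
  shows "increases_on X {0..<1} (\<lambda>q. measure X (positive_region X r0 \<beta> q r))"
    and "decreases_on X {0..<1} (\<lambda>q. measure X (negative_region X r0 \<beta> q r))"
proof -
  have T: "x_high X r0 \<beta> q r \<le> x_high X r0 \<beta> q' r" "x_low X r0 \<beta> q r < x_low X r0 \<beta> q' r"
    "x_low X r0 \<beta> q' r < r0 * mean X / r" "r0 * mean X / r < x_high X r0 \<beta> q r"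
    "strict_mono (cdf X) \<Longrightarrow> x_high X r0 \<beta> q r < x_high X r0 \<beta> q' r"
    if "q \<in> {0..<1}" "q' \<in> {0..<1}" "q < q'" for q q'
    using that assms r0_pos by (auto intro!: thresholds_information_high cutoff_between)
  show "increases_on X {0..<1} (\<lambda>q. measure X (positive_region X r0 \<beta> q r))"
    unfolding positive_region_def using T
    by (intro increases_onI measure_Icc_mono measure_Icc_strict disjI2) (auto simp: less_imp_le)
  show "decreases_on X {0..<1} (\<lambda>q. measure X (negative_region X r0 \<beta> q r))"
    unfolding negative_region_def using T
    by (intro decreases_onI measure_Icc_mono measure_Icc_strict disjI1) (auto simp: less_imp_le)
qed

text \<open>The misleading region is the positive region for \<open>r < r0\<close> and the negative
  one for \<open>r > r0\<close>, in each case the part that loses as \<open>q\<close> grows.\<close>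

lemma misleading_decreases_information:
  assumes "0 < \<beta>" "\<beta> < 1" "0 < r" "r \<noteq> r0"
  shows "decreases_on X {0..<1} (\<lambda>q. measure X (misleading_region X r0 \<beta> q r))"
proof (cases "r < r0")
  case True
  then show ?thesis
    using information_low(2)[OF assms(1-3)] by (simp add: misleading_region_def positive_region_def)
next
  case False
  then show ?thesis
    using information_high(2)[OF assms(1,2)] assms
    by (simp add: misleading_region_def negative_region_def)
qed

end

theorem corollary2:
  fixes f g :: "real \<Rightarrow> real" and R X :: "real measure" and r0 :: real
  assumes R_def: "R = density lborel (\<lambda>r. ennreal (f r))"
    and f: "f \<in> borel_measurable borel" "\<And>r. 0 \<le> f r"
    and R: "prob_space R" "AE r in R. 0 < r" "integrable R (\<lambda>r. r)"
    and r0: "r0 = mean R"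
    and X_def: "X = density lborel (\<lambda>x. ennreal (g x))"
    and g: "g \<in> borel_measurable borel" "\<And>x. 0 \<le> g x"
    and X: "prob_space X" "integrable X (\<lambda>x. x)" "0 < mean X"
  shows "
    (\<forall>q\<in>{0..<1}. \<forall>r>0. r \<noteq> r0 \<longrightarrow>
      decreases_on X {0<..<1} (\<lambda>\<beta>. measure X (misleading_region X r0 \<beta> q r))) \<and>
    (\<forall>\<beta>\<in>{0<..<1}. \<forall>r>0. r \<noteq> r0 \<longrightarrow>
      decreases_on X {0..<1} (\<lambda>q. measure X (misleading_region X r0 \<beta> q r))) \<and>
    (\<forall>q\<in>{0..<1}.
      decreases_on X {0<..<1} (\<lambda>\<beta>. ex_ante_prob R X (misleading_region X r0 \<beta> q))) \<and>
    (\<forall>\<beta>\<in>{0<..<1}.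
      decreases_on X {0..<1} (\<lambda>q. ex_ante_prob R X (misleading_region X r0 \<beta> q))) \<and>

    (\<forall>q\<in>{0..<1}. \<forall>r>0. r \<noteq> r0 \<longrightarrow>
      decreases_on X {0<..<1} (\<lambda>\<beta>. price_reaction X r0 \<beta> q r)) \<and>
    (\<forall>\<beta>\<in>{0<..<1}. \<forall>r>0. r \<noteq> r0 \<longrightarrow>
      increases_on X {0..<1} (\<lambda>q. price_reaction X r0 \<beta> q r)) \<and>

    (\<forall>A\<in>{negative_region, positive_region, overall_region}. \<forall>q\<in>{0..<1}.
      (\<forall>r>0. r \<noteq> r0 \<longrightarrow> decreases_on X {0<..<1} (\<lambda>\<beta>. measure X (A X r0 \<beta> q r))) \<and>
      decreases_on X {0<..<1} (\<lambda>\<beta>. ex_ante_prob R X (A X r0 \<beta> q))) \<and>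

    (\<forall>\<beta>\<in>{0<..<1}. \<forall>r>0.
      (r < r0 \<longrightarrow>
        increases_on X {0..<1} (\<lambda>q. measure X (negative_region X r0 \<beta> q r)) \<and>
        decreases_on X {0..<1} (\<lambda>q. measure X (positive_region X r0 \<beta> q r))) \<and>
      (r0 < r \<longrightarrow>
        increases_on X {0..<1} (\<lambda>q. measure X (positive_region X r0 \<beta> q r)) \<and>
        decreases_on X {0..<1} (\<lambda>q. measure X (negative_region X r0 \<beta> q r))))"
proof -
  interpret R: real_distribution R
    using R(1) by (simp add: real_distribution_def real_distribution_axioms_def R_def)
  have distr_X: "real_distribution X"
    using X(1) by (simp add: real_distribution_def real_distribution_axioms_def X_def)
  \<comment> \<open>Applied twice: to \<open>X\<close> it gives a continuous cdf, and to
    \<open>R\<close> it makes \<open>r = r0\<close> an event of probability zero.\<close>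
  have null: "{a} \<in> null_sets (density lborel (\<lambda>x. ennreal (h x)))"
    if "h \<in> borel_measurable borel" for a :: real and h
  proof -
    have "AE x in lborel. x \<in> {a} \<longrightarrow> ennreal (h x) = 0"
      using AE_lborel_singleton[of a] by eventually_elim auto
    then show ?thesis using that by (simp add: null_sets_density_iff)
  qed
  \<comment> \<open>An almost surely positive integrable variable has positive mean.\<close>
  have "0 < (\<integral>r. r \<partial>R)"
    using R.integral_less_AE_space[of "\<lambda>_. 0" "\<lambda>r. r"] R(2,3) by (simp add: R.emeasure_space_1[simplified])
  then have "0 < r0" by (simp add: r0 mean_def)
  interpret firm X r0
    using distr_X X(2,3) \<open>0 < r0\<close> null[OF g(1)]
    by (auto intro!: firm.intro firm_axioms.intro simp: X_def measure_def null_setsD1)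
  have "{r0} \<in> null_sets R"
    unfolding R_def by (rule null[OF f(1)])
  then have "AE r in R. r \<noteq> r0"
    using AE_not_in by fastforce
  note ex_ante = ex_ante_decreases[OF R.real_distribution_axioms R(2) this]
  show ?thesis
    by (intro conjI ballI allI impI ex_ante)
      (auto intro!: interval_regions regions_decrease_competence misleading_decreases_information
        price_reaction_decreases_competence price_reaction_increases_information
        information_low information_high)
qed

end
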